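(* Let $1<\alpha<\infty$, let $k_0\ge 0$ be an integer, and let $\{s_n\}_{n\ge1}$ be a sequence of positive numbers with $s_n\ge k_0+n-1$ for all $n\geq 1$ and $s_n/n\to\alpha$. Let $\{Z_n\}_{n\ge 1}$ be the Markov chain with $Z_1=k_0$ and, for $n\ge1$, $$\Pr(Z_{n+1}-Z_n=1\mid Z_n)=1-\frac{Z_n}{s_n},\qquad \Pr(Z_{n+1}-Z_n=0\mid Z_n)=\frac{Z_n}{s_n}.$$ Then $$\frac{Z_n}{n}\longrightarrow\frac{\alpha}{\alpha+1}\quad\text{almost surely},$$ and $$\frac{1}{\sqrt n}\left(Z_n-E[Z_n]\right)\longrightarrow N(0,\sigma^2)\quad\text{in distribution, where }\ \sigma^2=\frac{\alpha^2}{(1+\alpha)^2(2+\alpha)}.$$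
   Context: The convention $0/0=0$ is used; since $Z_n\le k_0+n-1\le s_n$, the transition probabilities lie in $[0,1]$. $N(0,\sigma^2)$ is the centered normal law with variance $\sigma^2$. *)

theory Defs
  imports "HOL-Probability.Probability"
begin

text \<open>
  Discrete-time, time-inhomogeneous Markov chain \<open>Z 1, Z 2, \<dots>\<close> with a countable state space.
  The value \<open>Z 0\<close> plays no role. The Markov property is required only for histories of positive
  probability, since \<^const>\<open>cond_prob\<close> given a null event is the junk value \<open>0\<close>.
\<close>

definition markov_chain :: "'a measure \<Rightarrow> (nat \<Rightarrow> 'a \<Rightarrow> 'b::countable) \<Rightarrow> bool" where
  "markov_chain M Z \<longleftrightarrow>
     prob_space M \<and>
     (\<forall>n\<ge>1. Z n \<in> measurable M (count_space UNIV)) \<and>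
     (\<forall>n\<ge>1. \<forall>z y. \<P>(x in M. \<forall>i\<in>{1..n}. Z i x = z i) > 0 \<longrightarrow>
        \<P>(x in M. Z (Suc n) x = y \<bar> \<forall>i\<in>{1..n}. Z i x = z i) =
        \<P>(x in M. Z (Suc n) x = y \<bar> Z n x = z n))"

text \<open>The centered normal law \<open>N(0, v)\<close> with variance \<open>v > 0\<close>;
  \<^const>\<open>normal_density\<close> takes the standard deviation as its second argument.\<close>

definition centered_normal :: "real \<Rightarrow> real measure" where
  "centered_normal v = density lborel (\<lambda>x. ennreal (normal_density 0 (sqrt v) x))"

end

theory Submission
  imports Defs
begin

text \<open>
  Only the one-step conditional law is needed. Put \<open>Y n = Z n - E[Z n]\<close>. The drift is
  linear in \<open>Z n\<close>, so \<open>Y (n+1) = (1 - 1 / s n) * Y n\<close> plus an increment that is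
  conditionally centred and has conditional variance \<open>q (1 - q)\<close>, \<open>q = Z n / s n\<close>. Hence
  \<open>E[Y n ^ 2] \<le> n\<close>, which gives \<open>Y n / n \<longlongrightarrow> 0\<close> almost surely along the squares and, as
  the increments of \<open>Y\<close> are bounded by \<open>1\<close>, along all \<open>n\<close>.

  For the central limit theorem, the same second moment bound shows that \<open>q\<close> may be replaced by
  its mean, and the characteristic function \<open>\<phi> n\<close> of \<open>Y n\<close> satisfies
  \<open>\<phi> (n+1) t \<approx> exp (- t^2 * d n / 2) * \<phi> n ((1 - 1 / s n) * t)\<close> with deterministic \<open>d n\<close> and an
  error \<open>o(t^2) + O(\<bar>t\<bar>^3 + t^4)\<close>. Iterating this at \<open>t / sqrt n\<close> leaves a Gaussian whose variance
  solves a linear recursion, and Levy's continuity theorem applies.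
\<close>

subsection \<open>Recurrences and Lipschitz sequences\<close>

text \<open>Once \<open>e n < r / 2\<close>, the sequence climbs with slope at most
  \<open>r / 2\<close>, and the starting value \<open>w N\<close> is absorbed by the other
  \<open>r / 2\<close> as soon as \<open>n > 2 * w N / r\<close>.\<close>

lemma sublinear_growth:
  fixes w e :: "nat \<Rightarrow> real"
  assumes nonneg: "\<And>n. 0 \<le> w n"
    and step: "\<forall>\<^sub>F n in sequentially. w (Suc n) \<le> w n + e n"
    and e: "e \<longlonglongrightarrow> 0"
  shows "(\<lambda>n. w n / real n) \<longlonglongrightarrow> 0"
proof (rule LIMSEQ_I)
  fix r :: real assume r: "0 < r"
  have "\<forall>\<^sub>F n in sequentially. e n < r / 2"
    using e r by (intro order_tendstoD) auto
  with step have "\<forall>\<^sub>F n in sequentially. w (Suc n) \<le> w n + r / 2"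
    by eventually_elim linarith
  then obtain N where N: "\<And>n. n \<ge> N \<Longrightarrow> w (Suc n) \<le> w n + r / 2"
    unfolding eventually_sequentially by blast
  have w_le: "w (N + k) \<le> w N + real k * (r / 2)" for k
  proof (induction k)
    case (Suc k)
    then show ?case using N[of "N + k"] by (simp add: algebra_simps add_divide_distrib)
  qed simp
  obtain K :: nat where K: "real K > 2 * w N / r"
    using reals_Archimedean2 by blast
  have "norm (w n / real n - 0) < r" if n: "n \<ge> max (Suc K) (Suc N)" for n
  proof -
    have "w n \<le> w N + real (n - N) * (r / 2)"
      using w_le[of "n - N"] n by simp
    also have "\<dots> \<le> w N + real n * (r / 2)"
      using r by (intro add_left_mono mult_right_mono) auto
    also have "w N < real n * (r / 2)"
    proof -
      have "2 * w N / r < real n" using K n by linarith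
      then show ?thesis using r by (simp add: field_simps)
    qed
    finally have "w n < r * real n" by simp
    then show ?thesis using nonneg[of n] n by (simp add: field_simps)
  qed
  then show "\<exists>no. \<forall>n\<ge>no. norm (w n / real n - 0) < r" by blast
qed

text \<open>The slope \<open>L\<close> solves the balance equation
  \<open>L = \<delta> - \<rho> * L\<close>. Subtracting the linear profile \<open>L * n\<close>
  leaves a non-expanding recursion whose forcing term \<open>e n\<close> tends to zero, so the
  remainder is sublinear. It serves the mean with \<open>\<rho> = 1 / \<alpha>\<close> and the
  variance with \<open>\<rho> = 2 / \<alpha>\<close>.\<close>

lemma linear_recurrence_limit:
  fixes x r d :: "nat \<Rightarrow> real"
  assumes step: "\<And>n. n \<ge> 1 \<Longrightarrow> x (Suc n) = (1 - r n) * x n + d n"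
    and r01: "\<forall>\<^sub>F n in sequentially. 0 \<le> r n \<and> r n \<le> 1"
    and r: "(\<lambda>n. real n * r n) \<longlonglongrightarrow> \<rho>" and \<rho>: "\<rho> \<ge> 0"
    and d: "d \<longlonglongrightarrow> \<delta>"
  shows "(\<lambda>n. x n / real n) \<longlonglongrightarrow> \<delta> / (1 + \<rho>)"
proof -
  define L where "L = \<delta> / (1 + \<rho>)"
  define w where "w n = x n - L * real n" for n
  define e where "e n = d n - L - L * (real n * r n)" for n
  have "L * (1 + \<rho>) = \<delta>"
    using \<rho> by (simp add: L_def)
  then have L: "\<delta> = L + L * \<rho>" by (simp add: algebra_simps)
  have "e \<longlonglongrightarrow> \<delta> - L - L * \<rho>"
    unfolding e_def by (intro tendsto_intros d r)
  then have "e \<longlonglongrightarrow> 0" by (simp add: L)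
  then have e: "(\<lambda>n. \<bar>e n\<bar>) \<longlonglongrightarrow> 0" by (rule tendsto_rabs_zero)
  have w_step: "w (Suc n) = (1 - r n) * w n + e n" if "n \<ge> 1" for n
    using step[OF that] by (simp add: w_def e_def algebra_simps)
  have "\<forall>\<^sub>F n in sequentially. \<bar>w (Suc n)\<bar> \<le> \<bar>w n\<bar> + \<bar>e n\<bar>"
    using r01 eventually_ge_at_top[of 1]
  proof eventually_elim
    case (elim n)
    have "\<bar>(1 - r n) * w n\<bar> \<le> \<bar>w n\<bar>"
      using elim by (auto simp: abs_mult intro!: mult_left_le_one_le)
    then show ?case unfolding w_step[OF elim(2)] by linarith
  qed
  then have "(\<lambda>n. \<bar>w n\<bar> / real n) \<longlonglongrightarrow> 0"
    by (intro sublinear_growth[OF _ _ e]) auto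
  then have "(\<lambda>n. \<bar>w n / real n\<bar>) \<longlonglongrightarrow> 0" by simp
  then have "(\<lambda>n. w n / real n) \<longlonglongrightarrow> 0" by (rule tendsto_rabs_zero_cancel)
  then have "(\<lambda>n. w n / real n + L) \<longlonglongrightarrow> 0 + L" by (intro tendsto_intros)
  moreover have "\<forall>\<^sub>F n in sequentially. w n / real n + L = x n / real n"
    using eventually_ge_at_top[of 1] by eventually_elim (simp add: w_def field_simps)
  ultimately show ?thesis
    unfolding L_def by (simp add: tendsto_cong)
qed

text \<open>If \<open>k\<close> is the integer square root of \<open>n\<close>, then
  \<open>n\<close> exceeds \<open>k^2\<close> by at most \<open>2 * k\<close>, so the Lipschitz
  bound costs only \<open>2 * k\<close>, which is negligible against
  \<open>n \<ge> k^2\<close>.\<close>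

lemma lipschitz_squares_LIMSEQ:
  fixes y :: "nat \<Rightarrow> real"
  assumes lip: "\<And>n. n \<ge> 1 \<Longrightarrow> \<bar>y (Suc n) - y n\<bar> \<le> 1"
    and squares: "(\<lambda>k. y ((Suc k)\<^sup>2) / real ((Suc k)\<^sup>2)) \<longlonglongrightarrow> 0"
  shows "(\<lambda>n. y n / real n) \<longlonglongrightarrow> 0"
proof -
  define root where "root n = nat \<lfloor>sqrt (real n)\<rfloor>" for n :: nat
  \<comment> \<open>\<open>g\<close> dominates the quotient at every \<open>n\<close> between
    \<open>k^2\<close> and \<open>k^2 + 2 * k\<close>; the term \<open>2 / k\<close> is the
    Lipschitz loss divided by \<open>k^2\<close>.\<close>
  define g where "g k = \<bar>y (k\<^sup>2) / real (k\<^sup>2)\<bar> + 2 / real k" for k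
  have root_lim: "filterlim root sequentially sequentially"
    unfolding root_def
    by (intro filterlim_compose[OF filterlim_nat_sequentially]
        filterlim_compose[OF filterlim_floor_sequentially]
        filterlim_compose[OF sqrt_at_top] filterlim_real_sequentially)
  have "(\<lambda>k. y (k\<^sup>2) / real (k\<^sup>2)) \<longlonglongrightarrow> 0"
    using squares by (rule LIMSEQ_imp_Suc)
  then have "g \<longlonglongrightarrow> 0 + 0"
    unfolding g_def by (intro tendsto_add tendsto_rabs_zero lim_const_over_n)
  then have "(\<lambda>n. g (root n)) \<longlonglongrightarrow> 0"
    using filterlim_compose[OF _ root_lim] by simp
  moreover have "\<forall>\<^sub>F n in sequentially. norm (y n / real n) \<le> g (root n)"
    using eventually_ge_at_top[of 1]
  proof eventually_elim
    case (elim n)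
    define k where "k = root n"
    have k: "real k \<le> sqrt n" "sqrt n < real k + 1" "k \<ge> 1"
      using elim by (auto simp: k_def root_def le_nat_floor)
    have k_sq: "(real k)\<^sup>2 \<le> real n" using power_mono[OF k(1), of 2] by simp
    then have k_le: "k\<^sup>2 \<le> n" by (simp only: of_nat_power[symmetric] of_nat_le_iff)
    have n_less: "real n \<le> (real k)\<^sup>2 + 2 * real k"
    proof -
      have "(sqrt n)\<^sup>2 < (real k + 1)\<^sup>2" using k(2) by (intro power_strict_mono) auto
      then have "real n < real ((k + 1)\<^sup>2)" by (simp add: add.commute)
      then have "n < (k + 1)\<^sup>2" by (simp only: of_nat_less_iff)
      then have "n \<le> k\<^sup>2 + 2 * k" by (simp add: power2_eq_square)
      then have "real n \<le> real (k\<^sup>2 + 2 * k)" by (simp only: of_nat_le_iff)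
      then show ?thesis by simp
    qed
    have diff: "\<bar>y (k\<^sup>2 + j) - y (k\<^sup>2)\<bar> \<le> real j" for j
    proof (induction j)
      case (Suc j)
      have "\<bar>y (Suc (k\<^sup>2 + j)) - y (k\<^sup>2 + j)\<bar> \<le> 1" using k(3) by (intro lip) (simp add: trans_le_add1)
      then show ?case using Suc by simp
    qed simp
    have "\<bar>y n\<bar> \<le> \<bar>y (k\<^sup>2)\<bar> + 2 * real k"
      using diff[of "n - k\<^sup>2"] k_le n_less by (simp add: of_nat_diff)
    then have "\<bar>y n\<bar> / real n \<le> (\<bar>y (k\<^sup>2)\<bar> + 2 * real k) / (real k)\<^sup>2"
      using k(3) k_sq by (intro frac_le) auto
    also have "\<dots> = g k" using k(3) by (simp add: g_def add_divide_distrib power2_eq_square)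
    finally show ?case by (simp add: k_def)
  qed
  ultimately show ?thesis by (rule Lim_null_comparison[rotated])
qed

subsection \<open>Bernoulli increments and the normal law\<close>

text \<open>The upper estimate comes from \<open>exp (- u) \<le> 1 / (1 + u)\<close> and the
  identity \<open>(1 - u + u^2) * (1 + u) = 1 + u^3 \<ge> 1\<close>.\<close>

lemma exp_minus_bounds:
  fixes u :: real
  assumes "0 \<le> u"
  shows "\<bar>exp (- u) - (1 - u)\<bar> \<le> u\<^sup>2"
proof -
  have "1 - u \<le> exp (- u)" using exp_ge_add_one_self[of "- u"] by simp
  moreover have "exp (- u) \<le> 1 - u + u\<^sup>2"
  proof -
    have "exp (- u) \<le> 1 / (1 + u)"
      using exp_ge_add_one_self[of u] assms by (simp add: exp_minus field_simps)
    also have "\<dots> \<le> 1 - u + u\<^sup>2"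
    proof -
      have "(1 - u + u\<^sup>2) * (1 + u) = 1 + u ^ 3" by (simp add: algebra_simps power2_eq_square power3_eq_cube)
      then show ?thesis using assms by (simp add: divide_le_eq)
    qed
    finally show ?thesis .
  qed
  ultimately show ?thesis by linarith
qed

lemma iexp_quadratic_bound:
  "norm (iexp x - (1 + \<i> * x - x\<^sup>2 / 2)) \<le> \<bar>x\<bar> ^ 3 / 6"
proof -
  have "(\<Sum>k\<le>2. (\<i> * complex_of_real x) ^ k / fact k) = 1 + \<i> * x - x\<^sup>2 / 2"
    by (simp add: numeral_2_eq_2 power_mult_distrib)
  then show ?thesis using iexp_approx1[of x 2] by (simp add: fact_numeral numeral_3_eq_3)
qed

text \<open>The left-hand side contains the characteristic function of the increment, which equals
  \<open>1\<close> with probability \<open>1 - q\<close> and \<open>0\<close> otherwise, centred at its conditional mean.\<close>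

lemma bernoulli_char_bound:
  fixes q c t :: real
  assumes q: "0 \<le> q" "q \<le> 1" and c: "0 \<le> c" "c \<le> 1"
  shows "norm ((1 - q) * iexp (t * q) + q * iexp (- t * (1 - q)) - exp (- (t\<^sup>2 * c / 2)))
    \<le> t\<^sup>2 / 2 * \<bar>q * (1 - q) - c\<bar> + \<bar>t\<bar> ^ 3 + t ^ 4"
proof -
  define R where "R x = iexp x - (1 + \<i> * complex_of_real x - x\<^sup>2 / 2)" for x :: real
  have R: "norm (R (t * y)) \<le> \<bar>t\<bar> ^ 3" if "\<bar>y\<bar> \<le> 1" for y
  proof -
    have "norm (R (t * y)) \<le> \<bar>t * y\<bar> ^ 3 / 6"
      unfolding R_def by (rule iexp_quadratic_bound)
    also have "\<dots> \<le> \<bar>t\<bar> ^ 3 * 1 / 1"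
      using that by (intro frac_le) (auto simp: abs_mult power_mult_distrib power_le_one intro!: mult_left_le)
    finally show ?thesis by simp
  qed
  have iexp: "iexp x = 1 + \<i> * complex_of_real x - x\<^sup>2 / 2 + R x" for x
    by (simp add: R_def)
  define u where "u = t\<^sup>2 * c / 2"
  have u: "0 \<le> u" "u \<le> t\<^sup>2"
    using c mult_left_mono[of c 2 "t\<^sup>2"] by (auto simp: u_def)
  \<comment> \<open>Centring makes the linear Taylor terms cancel, and the quadratic ones combine
    through \<open>(1 - q) * q^2 + q * (1 - q)^2 = q * (1 - q)\<close>. What remains is the variance
    mismatch, the error of linearizing \<open>exp (- u)\<close> and the cubic remainders.\<close>
  have "(1 - q) * iexp (t * q) + q * iexp (- t * (1 - q)) - exp (- u)
     = complex_of_real (t\<^sup>2 / 2 * (c - q * (1 - q))) + complex_of_real (1 - u - exp (- u))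
       + (complex_of_real (1 - q) * R (t * q) + complex_of_real q * R (t * (- (1 - q))))"
    by (subst (1 2) iexp) (simp add: u_def field_simps power2_eq_square)
  also have "norm \<dots> \<le> norm (complex_of_real (t\<^sup>2 / 2 * (c - q * (1 - q)))) + norm (complex_of_real (1 - u - exp (- u)))
       + (norm (complex_of_real (1 - q) * R (t * q)) + norm (complex_of_real q * R (t * (- (1 - q)))))"
    by (meson norm_triangle_le add_mono order_refl norm_triangle_ineq)
  also have "\<dots> = t\<^sup>2 / 2 * \<bar>q * (1 - q) - c\<bar> + \<bar>exp (- u) - (1 - u)\<bar>
       + ((1 - q) * norm (R (t * q)) + q * norm (R (t * (- (1 - q)))))"
    using q unfolding norm_mult norm_of_real abs_mult by (simp add: abs_minus_commute)
  also have "\<dots> \<le> t\<^sup>2 / 2 * \<bar>q * (1 - q) - c\<bar> + t ^ 4 + ((1 - q) * \<bar>t\<bar> ^ 3 + q * \<bar>t\<bar> ^ 3)"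
  proof (intro add_mono mult_left_mono R order_refl)
    have "u\<^sup>2 \<le> (t\<^sup>2)\<^sup>2" using u by (intro power_mono)
    then show "\<bar>exp (- u) - (1 - u)\<bar> \<le> t ^ 4"
      using exp_minus_bounds[OF u(1)] by simp
  qed (use q in auto)
  also have "(1 - q) * \<bar>t\<bar> ^ 3 + q * \<bar>t\<bar> ^ 3 = \<bar>t\<bar> ^ 3" by (simp add: algebra_simps)
  finally show ?thesis by (simp add: u_def algebra_simps)
qed

text \<open>The cross term equals \<open>- 2 * sn * (q - (1 - \<delta>))^2\<close>: the drift pulls
  the deviation \<open>y\<close> back towards zero, so only the bounded square of the increment can
  add to the second moment.\<close>

lemma bernoulli_second_moment_le:
  fixes q y sn \<delta> :: real
  assumes "0 \<le> q" "q \<le> 1" "0 \<le> \<delta>" "\<delta> \<le> 1" "sn > 0" "y / sn = q - (1 - \<delta>)"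
  shows "(1 - q) * (y + 1 - \<delta>)\<^sup>2 + q * (y - \<delta>)\<^sup>2 \<le> y\<^sup>2 + 1"
proof -
  have y: "y = sn * (q - (1 - \<delta>))" using assms by (simp add: field_simps)
  have "(1 - q) * (y + 1 - \<delta>)\<^sup>2 + q * (y - \<delta>)\<^sup>2 =
    y\<^sup>2 - 2 * (y * (q - (1 - \<delta>))) + ((1 - q) * (1 - \<delta>)\<^sup>2 + q * \<delta>\<^sup>2)"
    by (simp add: algebra_simps power2_eq_square)
  moreover have "y * (q - (1 - \<delta>)) \<ge> 0"
    unfolding y using assms by (simp add: mult.assoc)
  moreover have "(1 - q) * (1 - \<delta>)\<^sup>2 + q * \<delta>\<^sup>2 \<le> (1 - q) * 1 + q * 1"
    using assms by (intro add_mono mult_left_mono power_le_one) auto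
  ultimately show ?thesis by simp
qed

lemma real_distribution_centered_normal:
  assumes "v > 0"
  shows "real_distribution (centered_normal v)"
proof -
  have "prob_space (centered_normal v)"
    unfolding centered_normal_def using assms by (intro prob_space_normal_density) auto
  then show ?thesis
    by (auto simp: centered_normal_def real_distribution_def real_distribution_axioms_def)
qed

text \<open>The law is the image of the standard normal law under scaling by \<open>sqrt v\<close>,
  which rescales the argument of the characteristic function.\<close>

lemma char_centered_normal:
  assumes "v > 0"
  shows "char (centered_normal v) t = exp (- (t\<^sup>2 * v / 2))"
proof -
  interpret N: prob_space std_normal_distribution by (rule prob_space_normal_density) auto
  have "distributed std_normal_distribution lborel (\<lambda>x. x) (\<lambda>x. ennreal (std_normal_density x))"
    by (auto simp: distributed_def distr_id2)
  then have "distributed std_normal_distribution lborel (\<lambda>x. 0 + sqrt v * x)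
      (\<lambda>x. ennreal (normal_density (0 + sqrt v * 0) (\<bar>sqrt v\<bar> * 1) x))"
    using assms by (intro N.normal_density_affine) auto
  then have eq: "centered_normal v = distr std_normal_distribution lborel (\<lambda>x. sqrt v * x)"
    using assms by (simp add: centered_normal_def distributed_distr_eq_density[symmetric])
  have "char (centered_normal v) t = char std_normal_distribution (t * sqrt v)"
    unfolding char_def eq by (subst integral_distr) (auto simp: mult.assoc)
  also have "\<dots> = exp (- ((t * sqrt v)\<^sup>2) / 2)"
    by (simp add: char_std_normal_distribution)
  finally show ?thesis using assms by (simp add: power_mult_distrib)
qed

subsection \<open>Moments of the chain\<close>

text \<open>The one-step laws are stated as products, not as conditional probabilities, so that they
  hold for every integer \<open>k\<close>: for a state of probability zero both sides
  vanish.\<close>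

locale growth_chain = prob_space M for M :: "'a measure" +
  fixes Z :: "nat \<Rightarrow> 'a \<Rightarrow> int" and s :: "nat \<Rightarrow> real" and k0 :: nat
  assumes s_pos: "n \<ge> 1 \<Longrightarrow> s n > 0"
    and s_ge: "n \<ge> 1 \<Longrightarrow> s n \<ge> real k0 + real n - 1"
    and rv_Z: "n \<ge> 1 \<Longrightarrow> Z n \<in> measurable M (count_space UNIV)"
    and start: "AE x in M. Z 1 x = int k0"
    and step_up: "n \<ge> 1 \<Longrightarrow> prob {x \<in> space M. Z n x = k \<and> Z (Suc n) x = k + 1} =
      (1 - k / s n) * prob {x \<in> space M. Z n x = k}"
    and step_stay: "n \<ge> 1 \<Longrightarrow> prob {x \<in> space M. Z n x = k \<and> Z (Suc n) x = k} =
      k / s n * prob {x \<in> space M. Z n x = k}"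
begin

text \<open>For each \<open>k\<close> the two prescribed transitions already exhaust the mass of the
  event \<open>Z n = k\<close>, so any other transition is null; there are only countably many
  \<open>k\<close>.\<close>

lemma AE_step:
  assumes n: "n \<ge> 1"
  shows "AE x in M. Z (Suc n) x = Z n x \<or> Z (Suc n) x = Z n x + 1"
proof -
  note [measurable] = rv_Z[OF n] rv_Z[of "Suc n", simplified]
  have "AE x in M. Z n x = k \<longrightarrow> Z (Suc n) x = Z n x \<or> Z (Suc n) x = Z n x + 1" for k
  proof -
    let ?A = "{x \<in> space M. Z n x = k \<and> Z (Suc n) x = k + 1}"
    let ?B = "{x \<in> space M. Z n x = k \<and> Z (Suc n) x = k}"
    let ?C = "{x \<in> space M. Z n x = k \<and> Z (Suc n) x \<noteq> k \<and> Z (Suc n) x \<noteq> k + 1}"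
    have [measurable]: "?A \<in> events" "?B \<in> events" "?C \<in> events" by measurable
    have "prob {x \<in> space M. Z n x = k} = prob (?A \<union> (?B \<union> ?C))"
      by (rule arg_cong[where f = prob]) auto
    also have "\<dots> = prob ?A + prob (?B \<union> ?C)"
      by (rule finite_measure_Union) (measurable, auto)
    also have "prob (?B \<union> ?C) = prob ?B + prob ?C"
      by (rule finite_measure_Union) (measurable, auto)
    finally have "prob ?C = 0"
      unfolding step_up[OF n] step_stay[OF n] by (simp add: algebra_simps)
    then have "AE x in M. x \<notin> ?C"
      using prob_eq_0[of ?C] by simp
    with AE_space show ?thesis by eventually_elim auto
  qed
  then have "AE x in M. \<forall>k. Z n x = k \<longrightarrow> Z (Suc n) x = Z n x \<or> Z (Suc n) x = Z n x + 1"
    by (subst AE_all_countable) blast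
  then show ?thesis by eventually_elim blast
qed

text \<open>Almost surely only finitely many states are possible at time \<open>n\<close>. This
  makes every function of \<open>Z n\<close> integrable and turns expectations into finite
  sums.\<close>

lemma AE_range:
  assumes "n \<ge> 1"
  shows "AE x in M. Z n x \<in> {int k0..int k0 + int n - 1}"
  using assms
proof (induction n rule: dec_induct)
  case base
  show ?case using start by eventually_elim simp
next
  case (step n)
  from step.IH AE_step[OF step.hyps(1)] show ?case by eventually_elim auto
qed

lemma AE_ratio:
  assumes n: "n \<ge> 1"
  shows "AE x in M. 0 \<le> Z n x / s n \<and> Z n x / s n \<le> 1"
  using AE_range[OF n]
proof eventually_elim
  case (elim x)
  then have "0 \<le> Z n x" "Z n x \<le> int k0 + int n - 1" by auto
  then have "0 \<le> real_of_int (Z n x)" "real_of_int (Z n x) \<le> real_of_int (int k0 + int n - 1)"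
    by (simp, subst of_int_le_iff)
  then show ?case using s_pos[OF n] s_ge[OF n] by auto
qed

lemma borel_measurable_chain:
  assumes "n \<ge> 1"
  shows "(\<lambda>x. f (Z n x)) \<in> borel_measurable M"
  using measurable_compose[OF rv_Z[OF assms], of f borel] by simp

lemma integrable_chain:
  fixes f :: "int \<Rightarrow> 'b::{banach, second_countable_topology}"
  assumes n: "n \<ge> 1"
  shows "integrable M (\<lambda>x. f (Z n x))"
proof (rule integrable_const_bound)
  let ?I = "{int k0..int k0 + int n - 1}"
  show "AE x in M. norm (f (Z n x)) \<le> (\<Sum>k\<in>?I. norm (f k))"
    using AE_range[OF n] by eventually_elim (auto intro!: member_le_sum)
qed (rule borel_measurable_chain[OF n])

text \<open>This is the tower property for conditioning on \<open>Z n\<close>, obtained by summing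
  over the finitely many states. Values in a Banach space are allowed so that it covers both the
  real moments and the complex characteristic function.\<close>

lemma integral_step:
  fixes f :: "int \<Rightarrow> 'b::{banach, second_countable_topology}"
  assumes n: "n \<ge> 1"
  shows "(\<integral>x. f (Z (Suc n) x) \<partial>M) =
    (\<integral>x. (1 - Z n x / s n) *\<^sub>R f (Z n x + 1) + (Z n x / s n) *\<^sub>R f (Z n x) \<partial>M)"
proof -
  note [measurable] = rv_Z[OF n] rv_Z[of "Suc n", simplified]
  let ?I = "{int k0..int k0 + int n - 1}"
  let ?N = "\<lambda>k. {x \<in> space M. Z n x = k}"
  let ?A = "\<lambda>k. {x \<in> space M. Z n x = k \<and> Z (Suc n) x = k + 1}"
  let ?B = "\<lambda>k. {x \<in> space M. Z n x = k \<and> Z (Suc n) x = k}"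
  define g where "g k = (1 - k / s n) *\<^sub>R f (k + 1) + (k / s n) *\<^sub>R f k" for k :: int
  have ind: "integrable M (\<lambda>x. indicator E x *\<^sub>R c)" "(\<integral>x. indicator E x *\<^sub>R c \<partial>M) = prob E *\<^sub>R c"
    if [measurable]: "E \<in> events" for E and c :: 'b
    by (simp_all add: emeasure_eq_measure)
  have events [measurable]: "?A k \<in> events" "?B k \<in> events" "?N k \<in> events" for k by measurable
  \<comment> \<open>Almost surely exactly one indicator is nonzero: the index is
    \<open>k = Z n x\<close>, and the choice between \<open>?A\<close> and \<open>?B\<close> records
    whether the chain moves.\<close>
  have "AE x in M. f (Z (Suc n) x) =
      (\<Sum>k\<in>?I. indicator (?A k) x *\<^sub>R f (k + 1) + indicator (?B k) x *\<^sub>R f k)"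
    using AE_range[OF n] AE_step[OF n] AE_space
  proof eventually_elim
    case (elim x)
    then show ?case
      by (subst sum.remove[of _ "Z n x"])
         (auto simp: indicator_def intro!: sum.neutral)
  qed
  then have "(\<integral>x. f (Z (Suc n) x) \<partial>M) =
      (\<integral>x. (\<Sum>k\<in>?I. indicator (?A k) x *\<^sub>R f (k + 1) + indicator (?B k) x *\<^sub>R f k) \<partial>M)"
    by (intro integral_cong_AE) (use borel_measurable_chain[of "Suc n" f] in auto)
  also have "\<dots> = (\<Sum>k\<in>?I. prob (?A k) *\<^sub>R f (k + 1) + prob (?B k) *\<^sub>R f k)"
    by (simp add: ind Bochner_Integration.integral_sum Bochner_Integration.integral_add del: integral_scaleR_left integrable_scaleR_left)
  also have "\<dots> = (\<Sum>k\<in>?I. prob (?N k) *\<^sub>R g k)"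
    unfolding step_up[OF n] step_stay[OF n] g_def by (simp add: scaleR_add_right mult.commute)
  also have "\<dots> = (\<integral>x. (\<Sum>k\<in>?I. indicator (?N k) x *\<^sub>R g k) \<partial>M)"
    by (subst Bochner_Integration.integral_sum) (simp_all only: ind events)
  also have "\<dots> = (\<integral>x. g (Z n x) \<partial>M)"
  proof (rule integral_cong_AE)
    show "AE x in M. (\<Sum>k\<in>?I. indicator (?N k) x *\<^sub>R g k) = g (Z n x)"
      using AE_range[OF n] AE_space
    proof eventually_elim
      case (elim x)
      then show ?case
        by (subst sum.remove[of _ "Z n x"])
           (auto simp: indicator_def intro!: sum.neutral)
    qed
  qed (use borel_measurable_chain[OF n, of g] in auto)
  finally show ?thesis by (simp add: g_def)
qed

definition mean :: "nat \<Rightarrow> real" where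
  "mean n = expectation (\<lambda>x. real_of_int (Z n x))"

lemma mean_1: "mean 1 = real k0"
proof -
  have "mean 1 = (\<integral>x. real k0 \<partial>M)"
    unfolding mean_def
    by (rule integral_cong_AE) (use start borel_measurable_chain[of 1 real_of_int] in auto)
  then show ?thesis by (simp add: prob_space)
qed

lemma mean_Suc:
  assumes n: "n \<ge> 1"
  shows "mean (Suc n) = (1 - 1 / s n) * mean n + 1"
proof -
  have "mean (Suc n) = (\<integral>x. (1 - Z n x / s n) *\<^sub>R real_of_int (Z n x + 1) + (Z n x / s n) *\<^sub>R real_of_int (Z n x) \<partial>M)"
    unfolding mean_def by (rule integral_step[OF n])
  also have "\<dots> = (\<integral>x. (1 - 1 / s n) * real_of_int (Z n x) + 1 \<partial>M)"
    by (intro Bochner_Integration.integral_cong) (auto simp: algebra_simps add_divide_distrib)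
  also have "\<dots> = (1 - 1 / s n) * mean n + 1"
    unfolding mean_def using integrable_chain[OF n, of real_of_int] by (simp add: prob_space)
  finally show ?thesis .
qed

lemma mean_ratio:
  assumes n: "n \<ge> 1"
  shows "0 \<le> mean n / s n" "mean n / s n \<le> 1"
proof -
  have eq: "mean n / s n = expectation (\<lambda>x. Z n x / s n)"
    unfolding mean_def by simp
  have int: "integrable M (\<lambda>x. Z n x / s n)"
    using integrable_chain[OF n, of "\<lambda>k. k / s n"] .
  show "0 \<le> mean n / s n"
    unfolding eq using AE_ratio[OF n] by (intro integral_nonneg_AE) auto
  have "expectation (\<lambda>x. Z n x / s n) \<le> expectation (\<lambda>x. 1)"
    using AE_ratio[OF n] int by (intro integral_mono_AE) auto
  then show "mean n / s n \<le> 1" unfolding eq by (simp add: prob_space)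
qed

text \<open>The deviation starts at zero and, by \<open>bernoulli_second_moment_le\<close>, each
  step adds at most \<open>1\<close>.\<close>

lemma second_moment_le:
  assumes "n \<ge> 1"
  shows "expectation (\<lambda>x. (Z n x - mean n)\<^sup>2) \<le> real n"
  using assms
proof (induction n rule: dec_induct)
  case base
  have "expectation (\<lambda>x. (Z 1 x - mean 1)\<^sup>2) = (\<integral>x. 0 \<partial>M)"
    by (rule integral_cong_AE)
       (use start borel_measurable_chain[of 1 "\<lambda>k. (k - mean 1)\<^sup>2"] in \<open>auto simp: mean_1[simplified]\<close>)
  then show ?case by simp
next
  case (step n)
  note n = step.hyps(1)
  define \<delta> where "\<delta> = 1 - mean n / s n"
  have mean: "mean (Suc n) = mean n + \<delta>"
    using mean_Suc[OF n] by (simp add: \<delta>_def algebra_simps)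
  have "expectation (\<lambda>x. (Z (Suc n) x - mean (Suc n))\<^sup>2) =
    (\<integral>x. (1 - Z n x / s n) *\<^sub>R (real_of_int (Z n x + 1) - mean (Suc n))\<^sup>2
        + (Z n x / s n) *\<^sub>R (Z n x - mean (Suc n))\<^sup>2 \<partial>M)"
    by (rule integral_step[OF n])
  also have "\<dots> \<le> (\<integral>x. (Z n x - mean n)\<^sup>2 + 1 \<partial>M)"
  proof (rule integral_mono_AE)
    show "AE x in M. (1 - Z n x / s n) *\<^sub>R (real_of_int (Z n x + 1) - mean (Suc n))\<^sup>2
        + (Z n x / s n) *\<^sub>R (Z n x - mean (Suc n))\<^sup>2 \<le> (Z n x - mean n)\<^sup>2 + 1"
      using AE_ratio[OF n]
    proof eventually_elim
      case (elim x)
      have "(1 - Z n x / s n) * ((Z n x - mean n) + 1 - \<delta>)\<^sup>2 + Z n x / s n * ((Z n x - mean n) - \<delta>)\<^sup>2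
        \<le> (Z n x - mean n)\<^sup>2 + 1"
        using elim mean_ratio[OF n] s_pos[OF n]
        by (intro bernoulli_second_moment_le) (auto simp: \<delta>_def diff_divide_distrib)
      then show ?case by (simp add: mean algebra_simps)
    qed
  qed (use integrable_chain[OF n, of "\<lambda>k. (1 - k / s n) *\<^sub>R (real_of_int (k + 1) - mean (Suc n))\<^sup>2
        + (k / s n) *\<^sub>R (k - mean (Suc n))\<^sup>2"] integrable_chain[OF n, of "\<lambda>k. (k - mean n)\<^sup>2 + 1"] in simp_all)
  also have "\<dots> = expectation (\<lambda>x. (Z n x - mean n)\<^sup>2) + 1"
    using integrable_chain[OF n, of "\<lambda>k. (k - mean n)\<^sup>2"] by (simp add: prob_space)
  finally show ?case using step.IH by simp
qed

text \<open>Cauchy-Schwarz, in the form that the variance of the absolute deviation is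
  nonnegative.\<close>

lemma first_absolute_moment_le:
  assumes n: "n \<ge> 1"
  shows "expectation (\<lambda>x. \<bar>Z n x - mean n\<bar>) \<le> sqrt (real n)"
proof (rule real_le_rsqrt)
  let ?f = "\<lambda>x. \<bar>Z n x - mean n\<bar>"
  have "0 \<le> variance ?f" by (rule variance_positive)
  also have "\<dots> = expectation (\<lambda>x. (?f x)\<^sup>2) - (expectation ?f)\<^sup>2"
    using integrable_chain[OF n, of "\<lambda>k. \<bar>k - mean n\<bar>"] integrable_chain[OF n, of "\<lambda>k. (k - mean n)\<^sup>2"]
    by (intro variance_eq) auto
  finally show "(expectation ?f)\<^sup>2 \<le> real n"
    using second_moment_le[OF n] by simp
qed

subsection \<open>Characteristic functions\<close>

definition drift_var :: "nat \<Rightarrow> real" where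
  "drift_var n = mean n / s n * (1 - mean n / s n)"

text \<open>An approximation of the variance of \<open>Z n\<close>: the exact recursion has the mean of
  \<open>Z n / s n * (1 - Z n / s n)\<close> in place of \<open>drift_var n\<close>.\<close>

primrec var_approx :: "nat \<Rightarrow> real" where
  "var_approx 0 = 0"
| "var_approx (Suc n) = (if n = 0 then 0 else (1 - 1 / s n)\<^sup>2 * var_approx n + drift_var n)"

definition \<phi> :: "nat \<Rightarrow> real \<Rightarrow> complex" where
  "\<phi> n t = (CLINT x|M. iexp (t * (Z n x - mean n)))"

lemma drift_var_bounds:
  assumes "n \<ge> 1"
  shows "0 \<le> drift_var n" "drift_var n \<le> 1"
proof -
  note q = mean_ratio[OF assms]
  show "0 \<le> drift_var n"
    unfolding drift_var_def using q by (intro mult_nonneg_nonneg) auto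
  show "drift_var n \<le> 1"
    unfolding drift_var_def using q by (intro mult_le_one) auto
qed

text \<open>The map \<open>a * (1 - a)\<close> is 1-Lipschitz on the unit interval, so freezing the
  conditional variance at the mean costs at most the first absolute moment divided by
  \<open>s n\<close>.\<close>

lemma expectation_drift_var_deviation:
  assumes n: "n \<ge> 1"
  shows "expectation (\<lambda>x. \<bar>Z n x / s n * (1 - Z n x / s n) - drift_var n\<bar>) \<le> sqrt n / s n"
proof -
  have lip: "\<bar>a * (1 - a) - b * (1 - b)\<bar> \<le> \<bar>a - b\<bar>"
    if "0 \<le> a" "a \<le> 1" "0 \<le> b" "b \<le> 1" for a b :: real
  proof -
    have "a * (1 - a) - b * (1 - b) = (a - b) * (1 - a - b)" by (simp add: algebra_simps)
    also have "\<bar>\<dots>\<bar> \<le> \<bar>a - b\<bar>"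
      using that by (auto simp: abs_mult intro!: mult_left_le)
    finally show ?thesis .
  qed
  have "expectation (\<lambda>x. \<bar>Z n x / s n * (1 - Z n x / s n) - drift_var n\<bar>) \<le>
    expectation (\<lambda>x. \<bar>Z n x - mean n\<bar> / s n)"
  proof (rule integral_mono_AE)
    show "AE x in M. \<bar>Z n x / s n * (1 - Z n x / s n) - drift_var n\<bar> \<le> \<bar>Z n x - mean n\<bar> / s n"
      using AE_ratio[OF n]
    proof eventually_elim
      case (elim x)
      have "\<bar>Z n x / s n * (1 - Z n x / s n) - drift_var n\<bar> \<le> \<bar>Z n x / s n - mean n / s n\<bar>"
        unfolding drift_var_def using elim mean_ratio[OF n] by (intro lip) auto
      also have "\<dots> = \<bar>Z n x - mean n\<bar> / s n"
        using s_pos[OF n] by (simp add: diff_divide_distrib[symmetric])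
      finally show ?case .
    qed
  qed (use integrable_chain[OF n, of "\<lambda>k. \<bar>k / s n * (1 - k / s n) - drift_var n\<bar>"]
        integrable_chain[OF n, of "\<lambda>k. \<bar>k - mean n\<bar> / s n"] in simp_all)
  also have "\<dots> = expectation (\<lambda>x. \<bar>Z n x - mean n\<bar>) / s n" by simp
  also have "\<dots> \<le> sqrt n / s n"
    using first_absolute_moment_le[OF n] s_pos[OF n] by (intro divide_right_mono) auto
  finally show ?thesis .
qed

text \<open>Given \<open>Z n\<close>, the integrand factors into \<open>E\<close>, the integrand of
  \<open>\<phi> n\<close> at the contracted argument, and \<open>G\<close>, the characteristic
  function of the centred increment. Since \<open>E\<close> has modulus one, replacing
  \<open>G\<close> by the deterministic factor \<open>e\<close> costs only the mean of the bound in
  \<open>bernoulli_char_bound\<close>.\<close>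

lemma \<phi>_step:
  assumes n: "n \<ge> 1"
  shows "norm (\<phi> (Suc n) t - exp (- (t\<^sup>2 * drift_var n / 2)) * \<phi> n (t * (1 - 1 / s n)))
    \<le> t\<^sup>2 / 2 * (sqrt n / s n) + \<bar>t\<bar> ^ 3 + t ^ 4"
proof -
  define E where "E k = iexp (t * (1 - 1 / s n) * (k - mean n))" for k :: int
  define G where "G q = (1 - q) * iexp (t * q) + q * iexp (- t * (1 - q))" for q :: real
  define e where "e = complex_of_real (exp (- (t\<^sup>2 * drift_var n / 2)))"
  define D where "D q = \<bar>q * (1 - q) - drift_var n\<bar>" for q :: real
  \<comment> \<open>The splitting rests on the linear drift: \<open>k - mean (Suc n)\<close> is
    \<open>(1 - 1 / s n) * (k - mean n)\<close> plus the centred increment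
    \<open>- (1 - k / s n)\<close>.\<close>
  have factor: "(1 - k / s n) *\<^sub>R iexp (t * (real_of_int (k + 1) - mean (Suc n)))
      + (k / s n) *\<^sub>R iexp (t * (k - mean (Suc n))) = E k * G (k / s n)" for k :: int
  proof -
    have "t * (real_of_int (k + 1) - mean (Suc n)) = t * (1 - 1 / s n) * (k - mean n) + t * (k / s n)"
      using s_pos[OF n] unfolding mean_Suc[OF n] by (simp add: field_simps)
    then have 1: "iexp (t * (real_of_int (k + 1) - mean (Suc n))) = E k * iexp (t * (k / s n))"
      by (simp only: E_def of_real_add distrib_left exp_add)
    have "t * (k - mean (Suc n)) = t * (1 - 1 / s n) * (k - mean n) + (- t * (1 - k / s n))"
      using s_pos[OF n] unfolding mean_Suc[OF n] by (simp add: field_simps)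
    then have 2: "iexp (t * (k - mean (Suc n))) = E k * iexp (- t * (1 - k / s n))"
      by (simp only: E_def of_real_add distrib_left exp_add)
    show ?thesis
      unfolding 1 2 G_def scaleR_conv_of_real by (simp only: distrib_left mult.left_commute)
  qed
  have norm_E: "norm (E k) = 1" for k by (simp add: E_def)
  have intEG: "integrable M (\<lambda>x. E (Z n x) * G (Z n x / s n))"
    using integrable_chain[OF n, of "\<lambda>k. E k * G (k / s n)"] .
  have intE: "integrable M (\<lambda>x. e * E (Z n x))"
    using integrable_chain[OF n, of "\<lambda>k. e * E k"] .
  have intD: "integrable M (\<lambda>x. D (Z n x / s n))"
    using integrable_chain[OF n, of "\<lambda>k. D (k / s n)"] .
  have "\<phi> (Suc n) t = (CLINT x|M. E (Z n x) * G (Z n x / s n))"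
    unfolding \<phi>_def integral_step[OF n, of "\<lambda>k. iexp (t * (k - mean (Suc n)))"] factor ..
  moreover have "e * \<phi> n (t * (1 - 1 / s n)) = (CLINT x|M. e * E (Z n x))"
    unfolding \<phi>_def E_def by simp
  ultimately have "norm (\<phi> (Suc n) t - e * \<phi> n (t * (1 - 1 / s n))) =
      norm (CLINT x|M. E (Z n x) * G (Z n x / s n) - e * E (Z n x))"
    by (simp only: Bochner_Integration.integral_diff[OF intEG intE])
  also have "\<dots> \<le> (\<integral>x. norm (E (Z n x) * G (Z n x / s n) - e * E (Z n x)) \<partial>M)"
    by (rule integral_norm_bound)
  also have "\<dots> \<le> (\<integral>x. t\<^sup>2 / 2 * D (Z n x / s n) + (\<bar>t\<bar> ^ 3 + t ^ 4) \<partial>M)"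
  proof (rule integral_mono_AE)
    show "AE x in M. norm (E (Z n x) * G (Z n x / s n) - e * E (Z n x)) \<le>
        t\<^sup>2 / 2 * D (Z n x / s n) + (\<bar>t\<bar> ^ 3 + t ^ 4)"
      using AE_ratio[OF n]
    proof eventually_elim
      case (elim x)
      have "E (Z n x) * G (Z n x / s n) - e * E (Z n x) = E (Z n x) * (G (Z n x / s n) - e)"
        by (simp add: algebra_simps)
      then have "norm (E (Z n x) * G (Z n x / s n) - e * E (Z n x)) = norm (G (Z n x / s n) - e)"
        by (simp add: norm_mult norm_E)
      also have "\<dots> \<le> t\<^sup>2 / 2 * D (Z n x / s n) + \<bar>t\<bar> ^ 3 + t ^ 4"
        unfolding G_def e_def D_def using elim drift_var_bounds[OF n]
        by (intro bernoulli_char_bound) auto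
      finally show ?case by simp
    qed
  qed (use intEG intE intD in auto)
  also have "\<dots> = t\<^sup>2 / 2 * expectation (\<lambda>x. D (Z n x / s n)) + (\<bar>t\<bar> ^ 3 + t ^ 4)"
    using intD by (simp add: prob_space)
  also have "\<dots> \<le> t\<^sup>2 / 2 * (sqrt n / s n) + (\<bar>t\<bar> ^ 3 + t ^ 4)"
    using expectation_drift_var_deviation[OF n]
    by (intro add_mono mult_left_mono) (auto simp: D_def)
  finally show ?thesis by (simp add: e_def)
qed

lemma \<phi>_1: "\<phi> 1 t = 1"
proof -
  have "\<phi> 1 t = (CLINT x|M. 1)"
    unfolding \<phi>_def
    by (rule integral_cong_AE)
       (use start borel_measurable_chain[of 1 "\<lambda>k. iexp (t * (k - mean 1))"] in \<open>auto simp: mean_1[simplified]\<close>)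
  then show ?thesis by (simp add: prob_space)
qed

text \<open>Iterating \<open>\<phi>_step\<close> merely adds up the errors, because the Gaussian
  factors are at most \<open>1\<close> and contracting the argument does not enlarge the bound. The
  induction keeps \<open>t\<close> arbitrary, since each step passes to \<open>t'\<close>.\<close>

lemma \<phi>_bound:
  assumes "n \<ge> 1"
  shows "norm (\<phi> n t - exp (- (t\<^sup>2 * var_approx n / 2)))
    \<le> t\<^sup>2 / 2 * (\<Sum>i=1..<n. sqrt i / s i) + real (n - 1) * (\<bar>t\<bar> ^ 3 + t ^ 4)"
  using assms
proof (induction n arbitrary: t rule: dec_induct)
  case base
  then show ?case by (simp add: \<phi>_1[simplified])
next
  case (step n)
  note n = step.hyps(1)
  define t' where "t' = t * (1 - 1 / s n)"
  let ?B = "\<lambda>n t. t\<^sup>2 / 2 * (\<Sum>i=1..<n. sqrt i / s i) + real (n - 1) * (\<bar>t\<bar> ^ 3 + t ^ 4)"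
  let ?e = "exp (- (t\<^sup>2 * drift_var n / 2))"
  have B: "?B n t' \<le> ?B n t"
  \<comment> \<open>Only positivity of \<open>s 1\<close> is guaranteed when \<open>k0 = 0\<close>,
    so the factor \<open>1 - 1 / s 1\<close> may be large; for \<open>n = 1\<close>, however, both
    bounds are zero.\<close>
  proof (cases "n = 1")
    case False
    then have "s n \<ge> 1" using n s_ge[OF n] by simp
    then have "\<bar>t'\<bar> \<le> \<bar>t\<bar>"
      unfolding t'_def abs_mult by (intro mult_left_le) (auto simp: abs_le_iff field_simps)
    then have "\<bar>t'\<bar> ^ k \<le> \<bar>t\<bar> ^ k" for k by (intro power_mono) auto
    from this[of 2] this[of 3] this[of 4] show ?thesis
      using s_pos by (intro add_mono mult_mono mult_left_mono divide_right_mono sum_nonneg) (auto simp: less_imp_le)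
  qed simp
  have "t\<^sup>2 * var_approx (Suc n) / 2 = t\<^sup>2 * drift_var n / 2 + t'\<^sup>2 * var_approx n / 2"
    using n by (simp add: t'_def power_mult_distrib distrib_left add_divide_distrib del: power_divide)
  then have "exp (- (t\<^sup>2 * var_approx (Suc n) / 2)) = ?e * exp (- (t'\<^sup>2 * var_approx n / 2))"
    by (simp only: minus_add_distrib exp_add)
  then have "\<phi> (Suc n) t - exp (- (t\<^sup>2 * var_approx (Suc n) / 2)) =
      (\<phi> (Suc n) t - ?e * \<phi> n t') + ?e * (\<phi> n t' - exp (- (t'\<^sup>2 * var_approx n / 2)))"
    by (simp add: algebra_simps)
  also have "norm \<dots> \<le> norm (\<phi> (Suc n) t - ?e * \<phi> n t') + norm (?e * (\<phi> n t' - exp (- (t'\<^sup>2 * var_approx n / 2))))"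
    by (rule norm_triangle_ineq)
  also have "\<dots> \<le> (t\<^sup>2 / 2 * (sqrt n / s n) + \<bar>t\<bar> ^ 3 + t ^ 4) + ?B n t"
  proof (rule add_mono)
    show "norm (\<phi> (Suc n) t - ?e * \<phi> n t') \<le> t\<^sup>2 / 2 * (sqrt n / s n) + \<bar>t\<bar> ^ 3 + t ^ 4"
      unfolding t'_def by (rule \<phi>_step[OF n])
    have "norm (?e * (\<phi> n t' - exp (- (t'\<^sup>2 * var_approx n / 2)))) \<le> 1 * norm (\<phi> n t' - exp (- (t'\<^sup>2 * var_approx n / 2)))"
      unfolding norm_mult using drift_var_bounds[OF n] by (intro mult_right_mono) (auto simp: norm_of_real)
    then show "norm (?e * (\<phi> n t' - exp (- (t'\<^sup>2 * var_approx n / 2)))) \<le> ?B n t"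
      using step.IH[of t'] B by linarith
  qed
  also have "\<dots> = ?B (Suc n) t"
    using n by (simp add: algebra_simps of_nat_diff)
  finally show ?case .
qed

subsection \<open>Limit theorems\<close>

text \<open>Along \<open>N = (k + 1)^2\<close> the second moment of the quotient is at most
  \<open>1 / N\<close>, which is summable in \<open>k\<close>. Hence the sum of the squared
  quotients has finite expectation, is almost surely finite, and its terms tend to zero.\<close>

lemma AE_squares:
  "AE x in M. (\<lambda>k. (Z ((Suc k)\<^sup>2) x - mean ((Suc k)\<^sup>2)) / real ((Suc k)\<^sup>2)) \<longlonglongrightarrow> 0"
proof -
  define f where "f k x = ((Z ((Suc k)\<^sup>2) x - mean ((Suc k)\<^sup>2)) / real ((Suc k)\<^sup>2))\<^sup>2" for k x
  have int_f: "integrable M (f k)" for k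
    unfolding f_def
    using integrable_chain[of "(Suc k)\<^sup>2" "\<lambda>z. ((z - mean ((Suc k)\<^sup>2)) / real ((Suc k)\<^sup>2))\<^sup>2"] by simp
  have exp_f: "expectation (f k) \<le> inverse (real (Suc k) ^ 2)" for k
  proof -
    define N where "N = (Suc k)\<^sup>2"
    have N: "N \<ge> 1" by (simp add: N_def)
    have "expectation (f k) = expectation (\<lambda>x. (Z N x - mean N)\<^sup>2) / (real N)\<^sup>2"
      unfolding f_def N_def[symmetric] by (simp add: power_divide)
    also have "\<dots> \<le> real N / (real N)\<^sup>2"
      using second_moment_le[OF N] by (intro divide_right_mono) auto
    also have "\<dots> = inverse (real N)" using N by (simp add: power2_eq_square field_simps)
    finally show ?thesis by (simp add: N_def)
  qed
  have "summable (\<lambda>k. inverse (real (Suc k) ^ 2))"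
    using inverse_power_summable[of 2, where ?'a = real] by (subst summable_Suc_iff) simp
  then have sum: "(\<Sum>k. ennreal (inverse (real (Suc k) ^ 2))) \<noteq> top"
    by (subst suminf_ennreal2) auto
  have "(\<integral>\<^sup>+x. (\<Sum>k. ennreal (f k x)) \<partial>M) = (\<Sum>k. \<integral>\<^sup>+x. ennreal (f k x) \<partial>M)"
    using int_f by (intro nn_integral_suminf) auto
  also have "\<dots> = (\<Sum>k. ennreal (expectation (f k)))"
    by (intro suminf_cong nn_integral_eq_integral int_f) (auto simp: f_def)
  also have "\<dots> \<le> (\<Sum>k. ennreal (inverse (real (Suc k) ^ 2)))"
    by (intro suminf_le ennreal_leI exp_f) auto
  finally have "(\<integral>\<^sup>+x. (\<Sum>k. ennreal (f k x)) \<partial>M) \<noteq> \<infinity>"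
    using sum by (auto simp: top_unique)
  then have "AE x in M. (\<Sum>k. ennreal (f k x)) \<noteq> \<infinity>"
    using int_f by (intro nn_integral_PInf_AE) auto
  then show ?thesis
  proof eventually_elim
    case (elim x)
    then have "summable (\<lambda>k. f k x)"
      by (intro summable_suminf_not_top) (auto simp: f_def)
    then have "(\<lambda>k. f k x) \<longlonglongrightarrow> 0" by (rule summable_LIMSEQ_zero)
    then have "(\<lambda>k. sqrt (f k x)) \<longlonglongrightarrow> 0" using tendsto_real_sqrt by fastforce
    then show ?case unfolding f_def real_sqrt_abs by (rule tendsto_rabs_zero_cancel)
  qed
qed

lemma AE_centered_LIMSEQ:
  "AE x in M. (\<lambda>n. (Z n x - mean n) / real n) \<longlonglongrightarrow> 0"
proof -
  have "AE x in M. \<forall>n. n \<ge> 1 \<longrightarrow> Z (Suc n) x = Z n x \<or> Z (Suc n) x = Z n x + 1"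
    by (subst AE_all_countable) (use AE_step in auto)
  with AE_squares show ?thesis
  proof eventually_elim
    case (elim x)
    show ?case
    proof (rule lipschitz_squares_LIMSEQ)
      \<comment> \<open>Both \<open>Z\<close> and its mean increase by an amount in the unit
        interval, so the increments of their difference are bounded by \<open>1\<close>.\<close>
      fix n :: nat assume n: "n \<ge> 1"
      have "mean (Suc n) - mean n = 1 - mean n / s n"
        unfolding mean_Suc[OF n] by (simp add: algebra_simps)
      moreover have "Z (Suc n) x = Z n x \<or> Z (Suc n) x = Z n x + 1" using elim n by blast
      ultimately show "\<bar>(Z (Suc n) x - mean (Suc n)) - (Z n x - mean n)\<bar> \<le> 1"
        using mean_ratio[OF n] by auto
    qed (rule elim)
  qed
qed

end

section \<open>Asymptotics when \<open>s n / n\<close> tends to \<alpha>\<close>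

locale linear_growth_chain = growth_chain +
  fixes \<alpha> :: real
  assumes \<alpha>_pos: "\<alpha> > 0"
    and s_lim: "(\<lambda>n. s n / real n) \<longlonglongrightarrow> \<alpha>"
begin

lemma inverse_ratio_lim: "(\<lambda>n. real n / s n) \<longlonglongrightarrow> 1 / \<alpha>"
  using tendsto_inverse[OF s_lim] \<alpha>_pos by (simp add: inverse_eq_divide)

lemma inverse_lim: "(\<lambda>n. 1 / s n) \<longlonglongrightarrow> 0"
proof -
  have "(\<lambda>n. real n / s n * (1 / real n)) \<longlonglongrightarrow> 1 / \<alpha> * 0"
    by (intro tendsto_mult inverse_ratio_lim lim_const_over_n)
  moreover have "\<forall>\<^sub>F n in sequentially. real n / s n * (1 / real n) = 1 / s n"
    using eventually_ge_at_top[of 1] by eventually_elim simp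
  ultimately show ?thesis by (simp add: tendsto_cong)
qed

lemma eventually_inverse_unit: "\<forall>\<^sub>F n in sequentially. 0 \<le> 1 / s n \<and> 1 / s n \<le> 1"
  \<comment> \<open>From \<open>n = 2\<close> on, the lower bound \<open>k0 + n - 1\<close> on
    \<open>s n\<close> is at least \<open>1\<close>.\<close>
  using eventually_ge_at_top[of 2]
proof eventually_elim
  case (elim n)
  then show ?case using s_ge[of n] s_pos[of n] by simp
qed

lemma mean_lim: "(\<lambda>n. mean n / real n) \<longlonglongrightarrow> \<alpha> / (\<alpha> + 1)"
proof -
  have "(\<lambda>n. mean n / real n) \<longlonglongrightarrow> 1 / (1 + 1 / \<alpha>)"
    by (rule linear_recurrence_limit[where r = "\<lambda>n. 1 / s n" and d = "\<lambda>_. 1"])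
       (use mean_Suc eventually_inverse_unit inverse_ratio_lim \<alpha>_pos in auto)
  also have "1 / (1 + 1 / \<alpha>) = \<alpha> / (\<alpha> + 1)" using \<alpha>_pos by (simp add: field_simps)
  finally show ?thesis .
qed

lemma drift_var_lim: "drift_var \<longlonglongrightarrow> \<alpha> / (1 + \<alpha>)\<^sup>2"
proof -
  have "\<alpha> / (\<alpha> + 1) * (1 / \<alpha>) = 1 / (1 + \<alpha>)" using \<alpha>_pos by (simp add: field_simps)
  then have "(\<lambda>n. mean n / real n * (real n / s n)) \<longlonglongrightarrow> 1 / (1 + \<alpha>)"
    using tendsto_mult[OF mean_lim inverse_ratio_lim] by (simp only:)
  moreover have "\<forall>\<^sub>F n in sequentially. mean n / real n * (real n / s n) = mean n / s n"
    using eventually_ge_at_top[of 1] by eventually_elim simp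
  ultimately have q: "(\<lambda>n. mean n / s n) \<longlonglongrightarrow> 1 / (1 + \<alpha>)"
    by (rule Lim_transform_eventually)
  have "drift_var \<longlonglongrightarrow> 1 / (1 + \<alpha>) * (1 - 1 / (1 + \<alpha>))"
    unfolding drift_var_def by (intro tendsto_intros q)
  also have "1 / (1 + \<alpha>) * (1 - 1 / (1 + \<alpha>)) = \<alpha> / (1 + \<alpha>)\<^sup>2"
    using \<alpha>_pos by (simp add: field_simps power2_eq_square)
  finally show ?thesis .
qed

text \<open>The contraction rate is \<open>1 - (1 - 1 / s n)^2 = (1 / s n) * (2 - 1 / s n)\<close>,
  which gives \<open>\<rho> = 2 / \<alpha>\<close> in \<open>linear_recurrence_limit\<close>, with
  forcing limit \<open>\<alpha> / (1 + \<alpha>)^2\<close>.\<close>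

lemma var_approx_lim:
  "(\<lambda>n. var_approx n / real n) \<longlonglongrightarrow> \<alpha>\<^sup>2 / ((1 + \<alpha>)\<^sup>2 * (2 + \<alpha>))"
proof -
  let ?r = "\<lambda>n. 1 - (1 - 1 / s n)\<^sup>2"
  have "(\<lambda>n. var_approx n / real n) \<longlonglongrightarrow> (\<alpha> / (1 + \<alpha>)\<^sup>2) / (1 + 2 / \<alpha>)"
  proof (rule linear_recurrence_limit[where r = ?r and d = drift_var])
    show "var_approx (Suc n) = (1 - ?r n) * var_approx n + drift_var n" if "n \<ge> 1" for n
      using that by simp
    show "\<forall>\<^sub>F n in sequentially. 0 \<le> ?r n \<and> ?r n \<le> 1"
      using eventually_inverse_unit by eventually_elim (auto intro: power_le_one)
    have "(\<lambda>n. real n / s n * (2 - 1 / s n)) \<longlonglongrightarrow> 1 / \<alpha> * (2 - 0)"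
      by (intro tendsto_intros inverse_ratio_lim inverse_lim)
    moreover have "real n / s n * (2 - 1 / s n) = real n * ?r n" for n
      by (simp add: algebra_simps power2_eq_square add_divide_distrib diff_divide_distrib)
    ultimately show "(\<lambda>n. real n * ?r n) \<longlonglongrightarrow> 2 / \<alpha>" by simp
  qed (use \<alpha>_pos drift_var_lim in auto)
  also have "(\<alpha> / (1 + \<alpha>)\<^sup>2) / (1 + 2 / \<alpha>) = \<alpha>\<^sup>2 / ((1 + \<alpha>)\<^sup>2 * (2 + \<alpha>))"
    using \<alpha>_pos by (simp add: divide_simps) (simp add: algebra_simps power2_eq_square)
  finally show ?thesis .
qed

text \<open>A Cesaro argument: the summands \<open>sqrt i / s i\<close> are of order
  \<open>1 / sqrt i\<close> and tend to zero, hence so do their averages.\<close>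

lemma error_lim: "(\<lambda>n. (\<Sum>i=1..<n. sqrt i / s i) / real n) \<longlonglongrightarrow> 0"
proof (rule sublinear_growth[where e = "\<lambda>n. sqrt n / s n"])
  show "0 \<le> (\<Sum>i=1..<n. sqrt i / s i)" for n
    using s_pos by (intro sum_nonneg divide_nonneg_nonneg) (auto simp: less_imp_le)
  show "\<forall>\<^sub>F n in sequentially. (\<Sum>i=1..<Suc n. sqrt i / s i) \<le> (\<Sum>i=1..<n. sqrt i / s i) + sqrt n / s n"
    using eventually_ge_at_top[of 1] by eventually_elim simp
  have "(\<lambda>n. real n / s n * (1 / sqrt n)) \<longlonglongrightarrow> 1 / \<alpha> * 0"
    by (intro tendsto_mult inverse_ratio_lim tendsto_divide_0[OF tendsto_const] filterlim_at_top_imp_at_infinity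
      filterlim_compose[OF sqrt_at_top] filterlim_real_sequentially)
  moreover have "real n / s n * (1 / sqrt n) = sqrt n / s n" for n
    using real_div_sqrt[of "real n"] by (simp add: mult.commute flip: divide_divide_eq_left)
  ultimately show "(\<lambda>n. sqrt n / s n) \<longlonglongrightarrow> 0" by simp
qed

lemma AE_ratio_LIMSEQ: "AE x in M. (\<lambda>n. Z n x / real n) \<longlonglongrightarrow> \<alpha> / (\<alpha> + 1)"
  using AE_centered_LIMSEQ
proof eventually_elim
  case (elim x)
  then have "(\<lambda>n. (Z n x - mean n) / real n + mean n / real n) \<longlonglongrightarrow> 0 + \<alpha> / (\<alpha> + 1)"
    by (intro tendsto_add mean_lim)
  then show ?case by (simp add: diff_divide_distrib)
qed

text \<open>At argument \<open>t / sqrt n\<close> the quadratic error becomes a vanishing average,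
  while the \<open>n\<close> cubic and quartic errors total \<open>\<bar>t\<bar>^3 / sqrt n\<close>
  and \<open>t^4 / n\<close>. The remaining Gaussian has variance
  \<open>var_approx n / n\<close>.\<close>

lemma \<phi>_lim:
  "(\<lambda>n. \<phi> n (t / sqrt n)) \<longlonglongrightarrow> exp (- (t\<^sup>2 * (\<alpha>\<^sup>2 / ((1 + \<alpha>)\<^sup>2 * (2 + \<alpha>))) / 2))"
proof -
  define E where "E n = exp (- (t\<^sup>2 * (var_approx n / real n) / 2))" for n
  define B where "B n = t\<^sup>2 / 2 * ((\<Sum>i=1..<n. sqrt i / s i) / real n) + (\<bar>t\<bar> ^ 3 * (1 / sqrt n) + t ^ 4 * (1 / real n))" for n
  have inv_sqrt: "(\<lambda>n. 1 / sqrt (real n)) \<longlonglongrightarrow> 0"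
    by (intro tendsto_divide_0[OF tendsto_const] filterlim_at_top_imp_at_infinity
      filterlim_compose[OF sqrt_at_top] filterlim_real_sequentially)
  have "B \<longlonglongrightarrow> t\<^sup>2 / 2 * 0 + (\<bar>t\<bar> ^ 3 * 0 + t ^ 4 * 0)"
    unfolding B_def by (intro tendsto_add tendsto_mult tendsto_const error_lim inv_sqrt lim_const_over_n)
  then have B: "B \<longlonglongrightarrow> 0" by simp
  have "\<forall>\<^sub>F n in sequentially. norm (\<phi> n (t / sqrt n) - E n) \<le> B n"
    using eventually_ge_at_top[of 1]
  proof eventually_elim
    case (elim n)
    have sq: "(t / sqrt n)\<^sup>2 = t\<^sup>2 / n" by (simp add: power_divide)
    have cube: "real n * \<bar>t / sqrt n\<bar> ^ 3 = \<bar>t\<bar> ^ 3 * (1 / sqrt n)"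
      using elim by (simp add: power_divide abs_divide power3_eq_cube field_simps)
    have "(t / sqrt n) ^ 4 = ((t / sqrt n)\<^sup>2)\<^sup>2" by simp
    then have four: "real n * (t / sqrt n) ^ 4 = t ^ 4 * (1 / real n)"
      using elim unfolding sq by (simp add: power_divide power2_eq_square power4_eq_xxxx)
    have "norm (\<phi> n (t / sqrt n) - exp (- ((t / sqrt n)\<^sup>2 * var_approx n / 2)))
      \<le> (t / sqrt n)\<^sup>2 / 2 * (\<Sum>i=1..<n. sqrt i / s i) + real (n - 1) * (\<bar>t / sqrt n\<bar> ^ 3 + (t / sqrt n) ^ 4)"
      by (rule \<phi>_bound[OF elim])
    also have "\<dots> \<le> (t / sqrt n)\<^sup>2 / 2 * (\<Sum>i=1..<n. sqrt i / s i) + real n * (\<bar>t / sqrt n\<bar> ^ 3 + (t / sqrt n) ^ 4)"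
      by (intro add_left_mono mult_right_mono) auto
    also have "\<dots> = B n" unfolding B_def distrib_left cube four sq by simp
    also have "exp (- ((t / sqrt n)\<^sup>2 * var_approx n / 2)) = E n" by (simp add: E_def sq)
    finally show ?case .
  qed
  then have "(\<lambda>n. \<phi> n (t / sqrt n) - E n) \<longlonglongrightarrow> 0" by (rule Lim_null_comparison[OF _ B])
  moreover have "(\<lambda>n. complex_of_real (E n)) \<longlonglongrightarrow> exp (- (t\<^sup>2 * (\<alpha>\<^sup>2 / ((1 + \<alpha>)\<^sup>2 * (2 + \<alpha>))) / 2))"
    unfolding E_def by (intro tendsto_of_real tendsto_intros var_approx_lim) simp
  ultimately show ?thesis by (rule Lim_transform[rotated])
qed

lemma weak_conv_centered:
  "weak_conv_m (\<lambda>n. distr M borel (\<lambda>x. 1 / sqrt (real n) * (Z n x - mean n)))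
    (centered_normal (\<alpha>\<^sup>2 / ((1 + \<alpha>)\<^sup>2 * (2 + \<alpha>))))"
proof (rule levy_continuity)
  have v: "\<alpha>\<^sup>2 / ((1 + \<alpha>)\<^sup>2 * (2 + \<alpha>)) > 0" using \<alpha>_pos by simp
  \<comment> \<open>At \<open>n = 0\<close> the factor \<open>1 / sqrt 0\<close> is
    \<open>0\<close>, so the variable is constant although nothing is assumed about
    \<open>Z 0\<close>.\<close>
  have rv: "(\<lambda>x. 1 / sqrt (real n) * (Z n x - mean n)) \<in> borel_measurable M" for n
    using borel_measurable_chain[of n "\<lambda>k. 1 / sqrt (real n) * (k - mean n)"] by (cases "n = 0") auto
  show "real_distribution (distr M borel (\<lambda>x. 1 / sqrt (real n) * (Z n x - mean n)))" for n
    by (rule real_distribution_distr[OF rv])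
  show "real_distribution (centered_normal (\<alpha>\<^sup>2 / ((1 + \<alpha>)\<^sup>2 * (2 + \<alpha>))))"
    by (rule real_distribution_centered_normal[OF v])
  have "char (distr M borel (\<lambda>x. 1 / sqrt (real n) * (Z n x - mean n))) t = \<phi> n (t / sqrt n)" for n t
    unfolding char_def \<phi>_def by (subst integral_distr[OF rv]) (auto simp: mult.assoc)
  then show "(\<lambda>n. char (distr M borel (\<lambda>x. 1 / sqrt (real n) * (Z n x - mean n))) t)
      \<longlonglongrightarrow> char (centered_normal (\<alpha>\<^sup>2 / ((1 + \<alpha>)\<^sup>2 * (2 + \<alpha>)))) t" for t
    using \<phi>_lim[of t] by (simp only: char_centered_normal[OF v])
qed

end

section \<open>From conditional probabilities to the limit theorems\<close>

theorem theorem1p4: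
  fixes \<alpha> :: real and k0 :: nat and s :: "nat \<Rightarrow> real"
    and M :: "'a measure" and Z :: "nat \<Rightarrow> 'a \<Rightarrow> int"
  assumes "1 < \<alpha>"
    and "\<And>n. n \<ge> 1 \<Longrightarrow> s n > 0"
    and "\<And>n. n \<ge> 1 \<Longrightarrow> s n \<ge> real k0 + real n - 1"
    and "(\<lambda>n. s n / real n) \<longlonglongrightarrow> \<alpha>"
    and "markov_chain M Z"
    and "AE x in M. Z 1 x = int k0"
    and "\<And>n k. n \<ge> 1 \<Longrightarrow> \<P>(x in M. Z n x = k) > 0 \<Longrightarrow>
           \<P>(x in M. Z (Suc n) x - Z n x = 1 \<bar> Z n x = k) = 1 - real_of_int k / s n"
    and "\<And>n k. n \<ge> 1 \<Longrightarrow> \<P>(x in M. Z n x = k) > 0 \<Longrightarrow>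
           \<P>(x in M. Z (Suc n) x - Z n x = 0 \<bar> Z n x = k) = real_of_int k / s n"
  shows "(AE x in M. (\<lambda>n. real_of_int (Z n x) / real n) \<longlonglongrightarrow> \<alpha> / (\<alpha> + 1)) \<and>
    weak_conv_m
      (\<lambda>n. distr M borel
         (\<lambda>x. 1 / sqrt (real n) * (real_of_int (Z n x) - (\<integral>y. real_of_int (Z n y) \<partial>M))))
      (centered_normal (\<alpha>\<^sup>2 / ((1 + \<alpha>)\<^sup>2 * (2 + \<alpha>))))"
proof -
  interpret prob_space M using assms(5) by (simp add: markov_chain_def)
  have rv: "Z n \<in> measurable M (count_space UNIV)" if "n \<ge> 1" for n
    using assms(5) that by (simp add: markov_chain_def)
  \<comment> \<open>Clearing the denominator gives the product form when the state has positive
    probability; for a null state monotonicity makes both sides zero.\<close>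
  have joint: "prob {x \<in> space M. Z n x = k \<and> Z (Suc n) x = k + d} = p * prob {x \<in> space M. Z n x = k}"
    if n: "n \<ge> 1" and cond: "\<P>(x in M. Z n x = k) > 0 \<Longrightarrow> \<P>(x in M. Z (Suc n) x - Z n x = d \<bar> Z n x = k) = p"
    for n k d p
  proof (cases "\<P>(x in M. Z n x = k) > 0")
    case True
    have "{x \<in> space M. Z (Suc n) x - Z n x = d \<and> Z n x = k} = {x \<in> space M. Z n x = k \<and> Z (Suc n) x = k + d}"
      by auto
    then show ?thesis using cond[OF True] True by (simp add: cond_prob_def field_simps)
  next
    case False
    then have zero: "prob {x \<in> space M. Z n x = k} = 0" using measure_nonneg[of M] by (simp add: less_le)
    note [measurable] = rv[OF n]
    have "prob {x \<in> space M. Z n x = k \<and> Z (Suc n) x = k + d} \<le> prob {x \<in> space M. Z n x = k}"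
      by (rule finite_measure_mono) auto
    then show ?thesis using zero measure_nonneg[of M "{x \<in> space M. Z n x = k \<and> Z (Suc n) x = k + d}"] by simp
  qed
  interpret linear_growth_chain M Z s k0 \<alpha>
  proof unfold_locales
    show "prob {x \<in> space M. Z n x = k \<and> Z (Suc n) x = k + 1} = (1 - k / s n) * prob {x \<in> space M. Z n x = k}"
      if "n \<ge> 1" for n k
      using joint[OF that assms(7)[OF that]] .
    show "prob {x \<in> space M. Z n x = k \<and> Z (Suc n) x = k} = k / s n * prob {x \<in> space M. Z n x = k}"
      if "n \<ge> 1" for n k
      using joint[OF that assms(8)[OF that], of k] by simp
  qed (use assms rv in auto)
  show ?thesis
    using AE_ratio_LIMSEQ weak_conv_centered unfolding mean_def by blast
qed

end
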